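(* Let $\mathcal{H}$ be a complex Hilbert space, let $B\in\mathcal{B}(\mathcal{H})$, and consider $\begin{pmatrix} 0 & B\\ 0 & 0\end{pmatrix}\in\mathcal{B}(\mathcal{H}\oplus\mathcal{H})$. Then $$dw\begin{pmatrix} 0 & B\\ 0 & 0\end{pmatrix}=\begin{cases} 0, & B=0,\\ \dfrac{\|B\|}{2\sqrt{1-\|B\|^2}}, & \|B\|<\frac{1}{\sqrt{2}},\\ \|B\|^2, & \|B\|\geq\frac{1}{\sqrt{2}}.\end{cases}$$
   Context: $\mathcal{B}(\mathcal{H})$ is the algebra of bounded linear operators on the complex Hilbert space $\mathcal{H}$, with operator norm $\|\cdot\|$. A $2\times2$ operator matrix acts on the Hilbert space direct sum $\mathcal{H}\oplus\mathcal{H}$ (norm $\|(x,y)\|^2=\|x\|^2+\|y\|^2$) in the usual way. For a bounded operator $T$ on a complex Hilbert space, the Davis-Wielandt radius is $dw(T)=\sup\{\sqrt{|\langle Tz,z\rangle|^2+\|Tz\|^4}: \|z\|=1\}$. *)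

theory Defs
  imports "HOL-Analysis.Analysis"
begin

class complex_vector = real_vector +
  fixes scaleC :: "complex \<Rightarrow> 'a \<Rightarrow> 'a"  (infixr "*\<^sub>C" 75)
  assumes scaleC_add_right: "c *\<^sub>C (x + y) = c *\<^sub>C x + c *\<^sub>C y"
    and scaleC_add_left: "(c + d) *\<^sub>C x = c *\<^sub>C x + d *\<^sub>C x"
    and scaleC_scaleC: "c *\<^sub>C (d *\<^sub>C x) = (c * d) *\<^sub>C x"
    and scaleC_one: "1 *\<^sub>C x = x"
    and scaleR_scaleC: "r *\<^sub>R x = complex_of_real r *\<^sub>C x"

text \<open>The inner product is linear in its first argument. Positive definiteness is contained in
  \<open>cinner_self\<close>, since the norm of a \<open>real_normed_vector\<close> vanishes only at 0.\<close>

class complex_inner = complex_vector + real_normed_vector +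
  fixes cinner :: "'a \<Rightarrow> 'a \<Rightarrow> complex"
  assumes cinner_add_left: "cinner (x + y) z = cinner x z + cinner y z"
    and cinner_scaleC_left: "cinner (c *\<^sub>C x) y = c * cinner x y"
    and cinner_commute: "cinner x y = cnj (cinner y x)"
    and cinner_self: "cinner x x = complex_of_real ((norm x)\<^sup>2)"

class chilbert_space = complex_inner + complete_space

text \<open>The direct sum of two spaces is their product type; its norm is the library's Euclidean
  product norm \<open>norm_prod_def\<close>.\<close>

instantiation prod :: (complex_vector, complex_vector) complex_vector
begin

definition scaleC_prod_def: "c *\<^sub>C p = (c *\<^sub>C fst p, c *\<^sub>C snd p)"

instance
  by standard
    (simp_all add: scaleC_prod_def scaleC_add_right scaleC_add_left scaleC_scaleC scaleC_one
      scaleR_scaleC scaleR_prod_def)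

end

instantiation prod :: (complex_inner, complex_inner) complex_inner
begin

definition cinner_prod_def: "cinner p q = cinner (fst p) (fst q) + cinner (snd p) (snd q)"

instance
proof
  fix p q r :: "'a \<times> 'b" and c :: complex
  show "cinner (p + q) r = cinner p r + cinner q r"
    by (simp add: cinner_prod_def cinner_add_left)
  show "cinner (c *\<^sub>C p) q = c * cinner p q"
    by (simp add: cinner_prod_def scaleC_prod_def cinner_scaleC_left distrib_left)
  show "cinner p q = cnj (cinner q p)"
    unfolding cinner_prod_def complex_cnj_add
    using cinner_commute[of "fst p" "fst q"] cinner_commute[of "snd p" "snd q"] by simp
  show "cinner p p = complex_of_real ((norm p)\<^sup>2)"
    by (simp add: cinner_prod_def norm_prod_def cinner_self)
qed

end

instance prod :: (chilbert_space, chilbert_space) chilbert_space ..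

text \<open>Operators are functions satisfying the following predicate; their operator norm is the
  library's \<open>onorm\<close>.\<close>

definition bounded_clinear :: "('a::complex_inner \<Rightarrow> 'b::complex_inner) \<Rightarrow> bool" where
  "bounded_clinear T \<longleftrightarrow> bounded_linear T \<and> (\<forall>c x. T (c *\<^sub>C x) = c *\<^sub>C T x)"

definition op_matrix ::
  "('a \<Rightarrow> 'a) \<Rightarrow> ('a \<Rightarrow> 'a) \<Rightarrow> ('a \<Rightarrow> 'a) \<Rightarrow> ('a \<Rightarrow> 'a) \<Rightarrow> 'a \<times> 'a \<Rightarrow> 'a \<times> 'a::complex_inner" where
  "op_matrix A B C D = (\<lambda>(x, y). (A x + B y, C x + D y))"

lemma bounded_clinear_op_matrix:
  assumes "bounded_clinear A" "bounded_clinear B" "bounded_clinear C" "bounded_clinear D"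
  shows "bounded_clinear (op_matrix A B C D)"
proof -
  have "bounded_linear (\<lambda>p. (A (fst p) + B (snd p), C (fst p) + D (snd p)))"
    using assms unfolding bounded_clinear_def
    by (intro bounded_linear_Pair bounded_linear_add)
      (auto intro: bounded_linear_compose bounded_linear_fst bounded_linear_snd)
  with assms show ?thesis
    by (simp add: bounded_clinear_def op_matrix_def case_prod_beta' scaleC_prod_def scaleC_add_right)
qed

text \<open>On the zero space there is no unit vector, and the supremum of the empty set of nonnegative
  reals is taken to be 0; the library leaves \<open>Sup {}\<close> unspecified on \<open>real\<close>.\<close>

definition dw :: "('a::complex_inner \<Rightarrow> 'a) \<Rightarrow> real" where
  "dw T = (if \<exists>z::'a. norm z = 1
    then (SUP z\<in>{z. norm z = 1}. sqrt ((cmod (cinner (T z) z))\<^sup>2 + (norm (T z)) ^ 4))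
    else 0)"

end

(* For a unit vector z = (x, y) and T = (0 B; 0 0) we have T z = (B y, 0) and <T z, z> = <B y, x>.
   With b = ||B|| and s = ||y||^2, Cauchy-Schwarz bounds |<T z, z>|^2 + ||T z||^4 by
   b^2 s (1 - s) + b^4 s^2, and this bound is approached for every s in [0, 1] by taking y along
   an almost norming vector of B and x along B y. It remains to maximise the quadratic
   b^2 s (1 - (1 - b^2) s) over [0, 1]: the vertex s = 1 / (2 (1 - b^2)) lies inside exactly when
   b^2 < 1/2, and otherwise the maximum is at s = 1. *)
theory Submission
  imports Defs
begin

lemma cinner_add_right: "cinner x (y + z) = cinner x y + cinner x (z::'a::complex_inner)"
  by (metis cinner_add_left cinner_commute complex_cnj_add)

lemma cinner_scaleC_right: "cinner x (c *\<^sub>C y) = cnj c * cinner x (y::'a::complex_inner)"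
  by (metis cinner_scaleC_left cinner_commute complex_cnj_mult)

lemma cinner_zero_left [simp]: "cinner 0 (y::'a::complex_inner) = 0"
  using cinner_add_left[of 0 0 y] by simp

lemma cinner_zero_right [simp]: "cinner x (0::'a::complex_inner) = 0"
  using cinner_add_right[of x 0 0] by simp

lemma cinner_scaleR_left: "cinner (r *\<^sub>R x) (y::'a::complex_inner) = of_real r * cinner x y"
  by (simp add: scaleR_scaleC cinner_scaleC_left)

lemma cinner_scaleR_right: "cinner x (r *\<^sub>R y::'a::complex_inner) = of_real r * cinner x y"
  by (simp add: scaleR_scaleC cinner_scaleC_right)

lemma scaleC_zero_right [simp]: "c *\<^sub>C (0::'a::complex_vector) = 0"
  using scaleC_add_right[of c 0 "0::'a"] by simp

text \<open>The class axioms give homogeneity of the norm for real scalars only; the complex case is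
  recovered from the inner product through \<open>cinner_self\<close>.\<close>

lemma norm_scaleC: "norm (c *\<^sub>C x::'a::complex_inner) = cmod c * norm x"
proof -
  have "complex_of_real ((norm (c *\<^sub>C x))\<^sup>2) = (c * cnj c) * complex_of_real ((norm x)\<^sup>2)"
    by (simp only: cinner_self[symmetric] cinner_scaleC_left cinner_scaleC_right mult_ac)
  also have "\<dots> = complex_of_real ((cmod c * norm x)\<^sup>2)"
    by (simp add: power_mult_distrib complex_norm_square del: of_real_power)
  finally have "(norm (c *\<^sub>C x))\<^sup>2 = (cmod c * norm x)\<^sup>2"
    by (simp only: of_real_eq_iff)
  then show ?thesis
    by (simp add: power2_eq_iff_nonneg)
qed

lemma cmod_cinner_le: "cmod (cinner x y) \<le> norm x * norm (y::'a::complex_inner)"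
proof (cases "y = 0")
  case False
  define a where "a = cinner x y"
  define N where "N = (norm y)\<^sup>2"
  \<comment> \<open>This choice makes \<open>x + c *\<^sub>C y\<close> orthogonal to
    \<open>y\<close>. Below, the factor \<open>cnj a + cnj c * cinner y y\<close> vanishes because
    it is the inner product of \<open>y\<close> with that vector.\<close>
  define c where "c = - a / of_real N"
  have N: "N > 0"
    using False by (simp add: N_def)
  have yx: "cinner y x = cnj a"
    unfolding a_def by (rule cinner_commute)
  have aa: "a * cnj a = complex_of_real ((cmod a)\<^sup>2)"
    by (rule complex_norm_square[symmetric])
  have "complex_of_real ((norm (x + c *\<^sub>C y))\<^sup>2)
      = cinner x x + cnj c * a + c * (cnj a + cnj c * cinner y y)"
    by (simp add: cinner_self[symmetric] cinner_add_left cinner_add_right cinner_scaleC_left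
        cinner_scaleC_right yx a_def[symmetric] algebra_simps del: of_real_power)
  also have "cnj a + cnj c * cinner y y = 0"
    using N unfolding cinner_self N_def[symmetric] by (simp add: c_def)
  also have "cinner x x + cnj c * a + c * 0 = complex_of_real ((norm x)\<^sup>2) - a * cnj a / of_real N"
    by (simp add: cinner_self c_def)
  also have "\<dots> = complex_of_real ((norm x)\<^sup>2 - (cmod a)\<^sup>2 / N)"
    unfolding aa by simp
  finally have "(norm (x + c *\<^sub>C y))\<^sup>2 = (norm x)\<^sup>2 - (cmod a)\<^sup>2 / N"
    by (simp only: of_real_eq_iff)
  then have "(cmod a)\<^sup>2 / N \<le> (norm x)\<^sup>2"
    by (smt (verit) zero_le_power2)
  then have "(cmod a)\<^sup>2 \<le> (norm x * norm y)\<^sup>2"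
    using N by (simp add: divide_le_eq N_def power_mult_distrib)
  then show ?thesis
    unfolding a_def by (rule power2_le_imp_le) simp
qed simp

lemma dw_zero: "dw (\<lambda>_::'a::complex_inner. 0) = 0"
  unfolding dw_def by auto

text \<open>\<open>0 \<le> M\<close> serves twice: it allows taking square roots in the pointwise
  bound, and it covers the zero space, where \<open>dw T\<close> is 0 by convention.\<close>

lemma dw_le:
  assumes "0 \<le> M"
    and "\<And>z::'a::complex_inner. norm z = 1 \<Longrightarrow> (cmod (cinner (T z) z))\<^sup>2 + (norm (T z)) ^ 4 \<le> M\<^sup>2"
  shows "dw T \<le> M"
  unfolding dw_def using assms by (auto intro!: cSUP_least real_le_lsqrt)

text \<open>A real supremum dominates its members only if the set is bounded above. Here boundedness
  comes from Cauchy-Schwarz: on unit vectors both terms are controlled by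
  \<open>onorm T\<close>.\<close>

lemma le_dw:
  assumes "bounded_linear T" and "norm (z::'a::complex_inner) = 1"
  shows "sqrt ((cmod (cinner (T z) z))\<^sup>2 + (norm (T z)) ^ 4) \<le> dw T"
proof -
  have "bdd_above ((\<lambda>z. sqrt ((cmod (cinner (T z) z))\<^sup>2 + (norm (T z)) ^ 4)) ` {z. norm z = 1})"
  proof (rule bdd_aboveI2)
    fix w :: 'a
    assume "w \<in> {z. norm z = 1}"
    then have w: "norm w = 1"
      by simp
    have T: "norm (T w) \<le> onorm T"
      using onorm[OF assms(1), of w] w by simp
    have "cmod (cinner (T w) w) \<le> onorm T"
      using cmod_cinner_le[of "T w" w] T w by simp
    then show "sqrt ((cmod (cinner (T w) w))\<^sup>2 + (norm (T w)) ^ 4)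
        \<le> sqrt ((onorm T)\<^sup>2 + (onorm T) ^ 4)"
      using T by (intro real_sqrt_le_mono add_mono power_mono) auto
  qed
  then show ?thesis
    using assms(2) unfolding dw_def by (auto intro: cSUP_upper)
qed

text \<open>If \<open>norm (f x) \<le> c * norm x\<close> held for all \<open>x\<close>, then
  \<open>onorm f \<le> c\<close>. So some \<open>x\<close> violates it; such an \<open>x\<close> is
  nonzero and can be normalised.\<close>

lemma less_onorm_unit_vector:
  fixes f :: "'a::real_normed_vector \<Rightarrow> 'b::real_normed_vector"
  assumes "bounded_linear f" "0 \<le> c" "c < onorm f"
  obtains u where "norm u = 1" "c < norm (f u)"
proof -
  obtain x where x: "c * norm x < norm (f x)"
    using onorm_bound[OF assms(2), of f] assms(3) by (meson not_le)
  interpret f: bounded_linear f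
    by (rule assms(1))
  have "x \<noteq> 0"
    using x f.zero by auto
  then have "norm (x /\<^sub>R norm x) = 1" "c < norm (f (x /\<^sub>R norm x))"
    using x by (simp_all add: f.scaleR field_simps)
  then show thesis
    by (rule that)
qed

text \<open>This reduces the upper bound to a scalar inequality in \<open>s\<close>, so that the two
  regimes of \<open>onorm B\<close> differ only in how that inequality is verified.\<close>

lemma dw_offdiag_upper:
  fixes B :: "'a::complex_inner \<Rightarrow> 'a"
  assumes B: "bounded_linear B" and "0 \<le> M"
    and M: "\<And>s. 0 \<le> s \<Longrightarrow> s \<le> 1 \<Longrightarrow> (onorm B)\<^sup>2 * s * (1 - s) + (onorm B) ^ 4 * s\<^sup>2 \<le> M\<^sup>2"
  shows "dw (op_matrix (\<lambda>_. 0) B (\<lambda>_. 0) (\<lambda>_. 0)) \<le> M"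
proof (rule dw_le[OF \<open>0 \<le> M\<close>])
  fix z :: "'a \<times> 'a"
  assume z: "norm z = 1"
  obtain x y where xy: "z = (x, y)"
    by (cases z)
  define s where "s = (norm y)\<^sup>2"
  define w where "w = (norm (B y))\<^sup>2"
  have x: "(norm x)\<^sup>2 = 1 - s"
    using z by (simp add: xy norm_prod_def s_def)
  have s: "0 \<le> s" "s \<le> 1"
    using x by (simp_all add: s_def) (metis diff_ge_0_iff_ge zero_le_power2)
  have w: "0 \<le> w" "w \<le> (onorm B)\<^sup>2 * s"
    using power_mono[OF onorm[OF B, of y], of 2] by (simp_all add: w_def s_def power_mult_distrib)
  have "(cmod (cinner (B y) x))\<^sup>2 \<le> w * (1 - s)"
    using power_mono[OF cmod_cinner_le[of "B y" x], of 2]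
    by (simp add: w_def x[symmetric] power_mult_distrib)
  moreover have "norm (B y) ^ 4 = w\<^sup>2"
    by (simp add: w_def flip: power_mult)
  \<comment> \<open>For fixed \<open>s \<le> 1\<close> the left side increases with
    \<open>w \<ge> 0\<close>, so \<open>w\<close> may be replaced by its largest possible
    value.\<close>
  moreover have "w * (1 - s) + w\<^sup>2 \<le> ((onorm B)\<^sup>2 * s) * (1 - s) + ((onorm B)\<^sup>2 * s)\<^sup>2"
    using w s by (intro add_mono mult_right_mono power_mono) auto
  ultimately have "(cmod (cinner (B y) x))\<^sup>2 + norm (B y) ^ 4
      \<le> (onorm B)\<^sup>2 * s * (1 - s) + (onorm B) ^ 4 * s\<^sup>2"
    by (simp add: power_mult_distrib flip: power_mult)
  with M[OF s] show "(cmod (cinner (op_matrix (\<lambda>_. 0) B (\<lambda>_. 0) (\<lambda>_. 0) z) z))\<^sup>2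
      + norm (op_matrix (\<lambda>_. 0) B (\<lambda>_. 0) (\<lambda>_. 0) z) ^ 4 \<le> M\<^sup>2"
    by (simp add: xy op_matrix_def cinner_prod_def)
qed

lemma dw_offdiag_unit_vector:
  fixes B :: "'a::complex_inner \<Rightarrow> 'a"
  assumes B: "bounded_clinear B" and u: "norm u = 1" "B u \<noteq> 0" and s: "0 \<le> s" "s \<le> 1"
  shows "sqrt ((norm (B u))\<^sup>2 * s * (1 - s) + (norm (B u)) ^ 4 * s\<^sup>2)
    \<le> dw (op_matrix (\<lambda>_. 0) B (\<lambda>_. 0) (\<lambda>_. 0))"
proof -
  let ?T = "op_matrix (\<lambda>_. 0) B (\<lambda>_. 0) (\<lambda>_. 0)"
  define b where "b = norm (B u)"
  have b: "b > 0"
    using u by (simp add: b_def)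
  \<comment> \<open>The first component is parallel to the image under \<open>B\<close> of the
    second, which gives equality in Cauchy-Schwarz; dividing by \<open>b\<close> gives it norm
    \<open>sqrt (1 - s)\<close>, so that \<open>z\<close> is a unit vector.\<close>
  define z where "z = ((sqrt (1 - s) / b) *\<^sub>R B u, sqrt s *\<^sub>R u)"
  have z: "norm z = 1"
    using s b u by (simp add: z_def norm_prod_def flip: b_def)
  have T: "bounded_linear ?T"
    using bounded_clinear_op_matrix[of "\<lambda>_. 0" B "\<lambda>_. 0" "\<lambda>_. 0"] B
    by (simp add: bounded_clinear_def)
  have BL: "B (sqrt s *\<^sub>R u) = sqrt s *\<^sub>R B u"
    using B by (simp add: bounded_clinear_def linear_simps)
  have Tz: "?T z = (sqrt s *\<^sub>R B u, 0)"
    by (simp add: z_def op_matrix_def BL)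
  have "cinner (?T z) z = complex_of_real (sqrt s * (sqrt (1 - s) / b) * b\<^sup>2)"
    unfolding Tz
    by (simp add: z_def cinner_prod_def cinner_scaleR_left cinner_scaleR_right cinner_self
        flip: b_def)
  then have "cmod (cinner (?T z) z) = sqrt s * sqrt (1 - s) * b"
    using s b by (simp only: norm_of_real) (simp add: power2_eq_square)
  then have "(cmod (cinner (?T z) z))\<^sup>2 = b\<^sup>2 * s * (1 - s)"
    using s by (simp add: power_mult_distrib)
  moreover have "norm (?T z) ^ 4 = b ^ 4 * s\<^sup>2"
  proof -
    have "norm (?T z) ^ 4 = ((sqrt s)\<^sup>2 * b\<^sup>2)\<^sup>2"
      using s unfolding Tz
      by (simp add: power_mult_distrib flip: b_def power_mult del: real_sqrt_pow2)
    also have "\<dots> = b ^ 4 * s\<^sup>2"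
      using s by (simp add: power_mult_distrib flip: power_mult)
    finally show ?thesis .
  qed
  ultimately show ?thesis
    using le_dw[OF T z] by (simp add: b_def)
qed

text \<open>The operator norm need not be attained. The bound is therefore shown with every positive
  \<open>c < onorm B\<close> in its place, and continuity in \<open>c\<close> carries it to the
  limit from the left.\<close>

lemma dw_offdiag_lower:
  fixes B :: "'a::complex_inner \<Rightarrow> 'a"
  assumes B: "bounded_clinear B" and pos: "0 < onorm B" and s: "0 \<le> s" "s \<le> 1"
  shows "sqrt ((onorm B)\<^sup>2 * s * (1 - s) + (onorm B) ^ 4 * s\<^sup>2)
    \<le> dw (op_matrix (\<lambda>_. 0) B (\<lambda>_. 0) (\<lambda>_. 0))" (is "_ \<le> ?d")
proof -
  define f where "f = (\<lambda>c. sqrt (c\<^sup>2 * s * (1 - s) + c ^ 4 * s\<^sup>2))"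
  have "f c \<le> ?d" if c: "0 < c" "c < onorm B" for c
  proof -
    obtain u where u: "norm u = 1" "c < norm (B u)"
      using less_onorm_unit_vector[of B c] B c by (auto simp: bounded_clinear_def)
    have "f c \<le> f (norm (B u))"
      unfolding f_def using c u s
      by (intro real_sqrt_le_mono add_mono mult_right_mono power_mono) auto
    also have "\<dots> \<le> ?d"
      unfolding f_def using u c s by (intro dw_offdiag_unit_vector[OF B]) auto
    finally show ?thesis .
  qed
  then have "eventually (\<lambda>c. f c \<le> ?d) (at_left (onorm B))"
    using eventually_at_left_real[OF pos] by (auto elim: eventually_mono)
  moreover have "(f \<longlongrightarrow> f (onorm B)) (at_left (onorm B))"
    unfolding f_def by (intro tendsto_intros)
  ultimately have "f (onorm B) \<le> ?d"
    by (intro tendsto_upperbound) auto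
  then show ?thesis
    by (simp add: f_def)
qed

theorem theorem3p7:
  fixes B :: "'a::chilbert_space \<Rightarrow> 'a"
  assumes "bounded_clinear B"
  shows "dw (op_matrix (\<lambda>_. 0) B (\<lambda>_. 0) (\<lambda>_. 0)) =
    (if B = (\<lambda>_. 0) then 0
     else if onorm B < 1 / sqrt 2 then onorm B / (2 * sqrt (1 - (onorm B)\<^sup>2))
     else (onorm B)\<^sup>2)"
proof (cases "B = (\<lambda>_. 0)")
  case True
  then have "op_matrix (\<lambda>_. 0) B (\<lambda>_. 0) (\<lambda>_. 0) = (\<lambda>_. 0)"
    by (auto simp: op_matrix_def zero_prod_def)
  with True show ?thesis
    by (simp add: dw_zero)
next
  case False
  have BL: "bounded_linear B"
    using assms by (simp add: bounded_clinear_def)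
  define b where "b = onorm B"
  have b: "b > 0"
    using False onorm_pos_lt[OF BL] by (auto simp: b_def)
  note up = dw_offdiag_upper[OF BL, folded b_def]
  note lo = dw_offdiag_lower[OF assms, folded b_def, OF b]
  have sq: "b < 1 / sqrt 2 \<longleftrightarrow> b\<^sup>2 < 1 / 2"
    using b power_mono_iff[of "1 / sqrt 2" b 2] by (auto simp: power_divide not_le[symmetric])
  show ?thesis
  proof (cases "b < 1 / sqrt 2")
    case True
    define a where "a = 1 - b\<^sup>2"
    define M where "M = b / (2 * sqrt a)"
    have a: "1 / 2 < a"
      using True sq by (simp add: a_def)
    have M: "0 \<le> M" "M\<^sup>2 = b\<^sup>2 / (4 * a)"
      using a b by (simp_all add: M_def power_divide power_mult_distrib)
    \<comment> \<open>Completing the square: \<open>M\<^sup>2\<close> is the value at the vertex.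
      The upper bound follows since \<open>a > 0\<close> makes the subtracted term
      nonnegative.\<close>
    have square: "b\<^sup>2 * s * (1 - s) + b ^ 4 * s\<^sup>2 = M\<^sup>2 - b\<^sup>2 * (2 * a * s - 1)\<^sup>2 / (4 * a)" for s
    proof -
      have "b\<^sup>2 * s * (1 - s) + b ^ 4 * s\<^sup>2 = b\<^sup>2 * (s - a * s\<^sup>2)"
        by (simp add: a_def algebra_simps power2_eq_square power4_eq_xxxx)
      also have "\<dots> = M\<^sup>2 - b\<^sup>2 * (2 * a * s - 1)\<^sup>2 / (4 * a)"
        using a unfolding M(2) by (simp add: field_simps power2_eq_square)
      finally show ?thesis .
    qed
    \<comment> \<open>At \<open>s = 1 / (2 * a)\<close> the square vanishes; this point lies in the
      unit interval because \<open>a > 1 / 2\<close>.\<close>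
    have "sqrt (M\<^sup>2) \<le> dw (op_matrix (\<lambda>_. 0) B (\<lambda>_. 0) (\<lambda>_. 0))"
      using lo[of "1 / (2 * a)"] a unfolding square by (simp add: field_simps)
    moreover have "dw (op_matrix (\<lambda>_. 0) B (\<lambda>_. 0) (\<lambda>_. 0)) \<le> M"
      using a by (intro up M(1)) (simp add: square)
    ultimately have "dw (op_matrix (\<lambda>_. 0) B (\<lambda>_. 0) (\<lambda>_. 0)) = M"
      using M(1) by simp
    then show ?thesis
      using False True by (simp add: M_def a_def b_def)
  next
    case ge: False
    then have b2: "1 / 2 \<le> b\<^sup>2"
      using sq by simp
    \<comment> \<open>The right side minus the left factors as
      \<open>b\<^sup>2 * ((1 - s) * (b\<^sup>2 * (1 + s) - s))\<close>. This avoids separating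
      \<open>b < 1\<close>, where the quadratic is concave, from \<open>b \<ge> 1\<close>. The last
      factor is nonnegative because \<open>s \<le> (1 + s) / 2\<close>.\<close>
    have "b\<^sup>2 * s * (1 - s) + b ^ 4 * s\<^sup>2 \<le> (b\<^sup>2)\<^sup>2" if s: "0 \<le> s" "s \<le> 1" for s
    proof -
      have "1 / 2 * (1 + s) \<le> b\<^sup>2 * (1 + s)"
        using b2 s by (intro mult_right_mono) auto
      then have "s \<le> b\<^sup>2 * (1 + s)"
        using s by argo
      then have "0 \<le> b\<^sup>2 * ((1 - s) * (b\<^sup>2 * (1 + s) - s))"
        using s by simp
      also have "\<dots> = (b\<^sup>2)\<^sup>2 - (b\<^sup>2 * s * (1 - s) + b ^ 4 * s\<^sup>2)"
        by (simp add: algebra_simps power2_eq_square power4_eq_xxxx)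
      finally show ?thesis
        by simp
    qed
    then have "dw (op_matrix (\<lambda>_. 0) B (\<lambda>_. 0) (\<lambda>_. 0)) \<le> b\<^sup>2"
      by (intro up) auto
    \<comment> \<open>The maximum is at the endpoint \<open>s = 1\<close>, where the expression
      equals \<open>b ^ 4\<close>.\<close>
    moreover have "b\<^sup>2 \<le> dw (op_matrix (\<lambda>_. 0) B (\<lambda>_. 0) (\<lambda>_. 0))"
      using lo[of 1] real_sqrt_abs[of "b\<^sup>2"] by (simp flip: power_mult)
    ultimately show ?thesis
      using False ge by (simp add: b_def)
  qed
qed

end
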